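(* Let $Q:\mathcal H\to\mathcal H$ be semantics preserving. Then $Q$ induces the identity map on the predictive quotient $\mathcal S$. Suppose that near $h$, $\pi$ is represented by a $C^1$ submersion of rank $k$, and that $Q(h)=h$. Then $$D\pi_h(DQ_h-I)=0,\qquad \operatorname{rank}(DQ_h)\ge k,\qquad \dim\ker DQ_h\le d-k.$$ Consequently, at most $d-k$ independent local directions can be eliminated by an exact corrector. If a $C^1$ local section $E:\mathcal S\to\mathcal H$ exists, the canonicalizer $Q^\star=E\circ\pi$ is an idempotent corrector with rank $k$ along $E(\mathcal S)$.
   Context: $\mathcal H\subseteq\mathbb R^d$ is a recurrent hidden-state domain. $\mathcal W$ is a set of future tests; each test $w\in\mathcal W$ has a bounded outcome $Y_w\in[0,1]$, and $\phi_w(h)=\mathbb E[Y_w\mid h]$ for $h\in\mathcal H$. Put $\Phi_\infty(h)=(\phi_w(h))_{w\in\mathcal W}$. Two hidden states are predictively equivalent, $h\sim h'$, precisely when $\Phi_\infty(h)=\Phi_\infty(h')$. The predictive quotient (predictive state space) is $\mathcal S=\mathcal H/{\sim}$, and $\pi:\mathcal H\to\mathcal S$ is the canonical projection. The equivalence classes $\pi^{-1}(s)$ are called predictive fibers. A map $Q:\mathcal H\to\mathcal H$ is semantics preserving on a domain $D\subseteq\mathcal H$ if $\pi(Q(h))=\pi(h)$ for all $h\in D$; equivalently, $Q$ maps every hidden state of $D$ into its own predictive fiber. "Semantics preserving" without mention of a domain means $\pi\circ Q=\pi$. "Exact corrector" means a semantics-preserving map. A section $E$ satisfies $\pi\circ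 E=I$ (the identity). $D\pi_h$ and $DQ_h$ denote derivatives at $h$; $I$ in the displayed identity is the identity on $\mathbb R^d$. *)

theory Defs
  imports "HOL-Probability.Probability"
begin

(* Given hidden state h, the future is distributed according to the probability measure P h on
   the sample space M; the outcome of test w is the random variable Y w. *)
locale predictive_model =
  fixes H :: "(real ^ 'd) set"
    and W :: "'w set"
    and M :: "'o measure"
    and P :: "real ^ 'd \<Rightarrow> 'o measure"
    and Y :: "'w \<Rightarrow> 'o \<Rightarrow> real"
  assumes law: "\<And>h. h \<in> H \<Longrightarrow> P h \<in> space (prob_algebra M)"
    and outcome_measurable: "\<And>w. w \<in> W \<Longrightarrow> Y w \<in> borel_measurable M"
    and outcome_bounded: "\<And>w \<omega>. w \<in> W \<Longrightarrow> \<omega> \<in> space M \<Longrightarrow> Y w \<omega> \<in> {0..1}"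

definition predictive_map ::
    "'w set \<Rightarrow> ('h \<Rightarrow> 'o measure) \<Rightarrow> ('w \<Rightarrow> 'o \<Rightarrow> real) \<Rightarrow> 'h \<Rightarrow> 'w \<Rightarrow> real" where
  "predictive_map W P Y h = (\<lambda>w\<in>W. integral\<^sup>L (P h) (Y w))"

definition predictive_equiv :: "'h set \<Rightarrow> ('h \<Rightarrow> 'v) \<Rightarrow> ('h \<times> 'h) set" where
  "predictive_equiv H \<Phi> = {(h, h'). h \<in> H \<and> h' \<in> H \<and> \<Phi> h = \<Phi> h'}"

definition predictive_quotient :: "'h set \<Rightarrow> ('h \<Rightarrow> 'v) \<Rightarrow> 'h set set" where
  "predictive_quotient H \<Phi> = H // predictive_equiv H \<Phi>"

definition predictive_proj :: "'h set \<Rightarrow> ('h \<Rightarrow> 'v) \<Rightarrow> 'h \<Rightarrow> 'h set" where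
  "predictive_proj H \<Phi> h = predictive_equiv H \<Phi> `` {h}"

definition semantics_preserving_on :: "('h \<Rightarrow> 's) \<Rightarrow> 'h set \<Rightarrow> ('h \<Rightarrow> 'h) \<Rightarrow> bool" where
  "semantics_preserving_on \<pi> D Q \<longleftrightarrow> (\<forall>h\<in>D. \<pi> (Q h) = \<pi> h)"

definition induces_on_quotient ::
    "'h set \<Rightarrow> 's set \<Rightarrow> ('h \<Rightarrow> 's) \<Rightarrow> ('h \<Rightarrow> 'h) \<Rightarrow> ('s \<Rightarrow> 's) \<Rightarrow> bool" where
  "induces_on_quotient H S \<pi> Q f \<longleftrightarrow> f \<in> S \<rightarrow> S \<and> (\<forall>h\<in>H. f (\<pi> h) = \<pi> (Q h))"

(* Used only for sets N that are open in a linear subspace; the derivative is relative to N. *)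
definition C1_on :: "'a::euclidean_space set \<Rightarrow> ('a \<Rightarrow> 'b::euclidean_space) \<Rightarrow> bool" where
  "C1_on N f \<longleftrightarrow>
     (\<exists>f' :: 'a \<Rightarrow> 'a \<Rightarrow>\<^sub>L 'b.
        (\<forall>x\<in>N. (f has_derivative blinfun_apply (f' x)) (at x within N)) \<and> continuous_on N f')"

(* \<kappa> is a local coordinate system of the quotient on \<pi> ` U, with values in a k-dimensional
   linear space F, in which \<pi> becomes the C^1 submersion \<kappa> \<circ> \<pi> from U to F. The model space is
   a subspace F of a Euclidean space, rather than a type real ^ 'k, in order to admit k = 0. *)
definition submersion_near ::
    "'a::euclidean_space set \<Rightarrow> ('a \<Rightarrow> 's) \<Rightarrow> 'b::euclidean_space set \<Rightarrow> nat \<Rightarrow> 'a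
      \<Rightarrow> 'a set \<Rightarrow> ('s \<Rightarrow> 'b) \<Rightarrow> bool" where
  "submersion_near H \<pi> F k h U \<kappa> \<longleftrightarrow>
     subspace F \<and> dim F = k \<and>
     open U \<and> h \<in> U \<and> U \<subseteq> H \<and>
     inj_on \<kappa> (\<pi> ` U) \<and> \<kappa> ` \<pi> ` U \<subseteq> F \<and>
     C1_on U (\<kappa> \<circ> \<pi>) \<and>
     (\<forall>x\<in>U. range (frechet_derivative (\<kappa> \<circ> \<pi>) (at x)) = F)"

definition local_section ::
    "'h set \<Rightarrow> 's set \<Rightarrow> ('h \<Rightarrow> 's) \<Rightarrow> 's set \<Rightarrow> ('s \<Rightarrow> 'h) \<Rightarrow> bool" where
  "local_section H S \<pi> V E \<longleftrightarrow> V \<subseteq> S \<and> E \<in> V \<rightarrow> H \<and> (\<forall>s\<in>V. \<pi> (E s) = s)"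

(* In the coordinates \<kappa> on \<pi> ` U, the set V contains a neighbourhood of s on which E is C^1. *)
definition C1_near_in_chart ::
    "('a::euclidean_space \<Rightarrow> 's) \<Rightarrow> 'b::euclidean_space set \<Rightarrow> 'a set \<Rightarrow> ('s \<Rightarrow> 'b)
      \<Rightarrow> 's set \<Rightarrow> ('s \<Rightarrow> 'a) \<Rightarrow> 's \<Rightarrow> bool" where
  "C1_near_in_chart \<pi> F U \<kappa> V E s \<longleftrightarrow>
     (\<exists>N. openin (top_of_set F) N \<and> \<kappa> s \<in> N \<and> N \<subseteq> \<kappa> ` (V \<inter> \<pi> ` U) \<and>
          C1_on N (E \<circ> inv_into (\<pi> ` U) \<kappa>))"

(* The charts at different points need not form an atlas: the C^1 condition at s only refers to
   the coordinates in which \<pi> is a submersion near E s. *)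
definition C1_local_section ::
    "'a::euclidean_space set \<Rightarrow> 's set \<Rightarrow> ('a \<Rightarrow> 's) \<Rightarrow> 'b::euclidean_space set \<Rightarrow> nat
      \<Rightarrow> 's set \<Rightarrow> ('s \<Rightarrow> 'a) \<Rightarrow> bool" where
  "C1_local_section H S \<pi> F k V E \<longleftrightarrow>
     local_section H S \<pi> V E \<and>
     (\<forall>s\<in>V. \<exists>U \<kappa>. submersion_near H \<pi> F k (E s) U \<kappa> \<and> C1_near_in_chart \<pi> F U \<kappa> V E s)"

end

(* Differentiating pi o Q = pi at a fixed point of Q gives Dpi o DQ = Dpi, so DQ has rank at least
   that of Dpi. The derivative of E o pi factors through the k-dimensional space F, which bounds
   its rank by k from above; the lower bound applies to it too, as E o pi fixes each E s. *)
theory Submission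
  imports Defs
begin

lemma rank_matrix_eq_dim_range:
  fixes f :: "real ^ 'n \<Rightarrow> real ^ 'm"
  assumes "linear f"
  shows "rank (matrix f) = dim (range f)"
  using assms by (simp add: rank_dim_range matrix_works)

text \<open>Near \<open>h\<close> the maps \<open>f \<circ> Q\<close> and \<open>f\<close> agree, so
  they have the same derivative there. The chain rule evaluates the derivative of \<open>f\<close>
  at \<open>Q h\<close>; because \<open>Q h = h\<close>, this is again \<open>Df\<close>, and
  uniqueness of derivatives applies.\<close>

lemma has_derivative_fixed_point_factor:
  fixes f :: "'a::euclidean_space \<Rightarrow> 'b::euclidean_space"
  assumes "open U" "h \<in> U" and "Q h = h"
    and eq: "\<And>x. x \<in> U \<Longrightarrow> f (Q x) = f x"
    and f: "(f has_derivative Df) (at h)" and Q: "(Q has_derivative DQ) (at h)"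
  shows "Df (DQ v) = Df v"
proof -
  have "(f \<circ> Q has_derivative Df \<circ> DQ) (at h)"
    using Q f \<open>Q h = h\<close> by (intro diff_chain_at) simp_all
  then have "(f has_derivative Df \<circ> DQ) (at h)"
    by (rule has_derivative_transform_within_open[OF _ \<open>open U\<close> \<open>h \<in> U\<close>]) (simp add: eq)
  then have "Df \<circ> DQ = Df"
    using f by (rule has_derivative_unique)
  then show ?thesis by (metis comp_apply)
qed

text \<open>Since \<open>f\<close> takes the same values on \<open>range g\<close> as on the whole
  space, \<open>range f\<close> is a linear image of \<open>range g\<close>, and a linear image
  cannot have larger dimension.\<close>

lemma dim_range_le_of_factor:
  fixes f :: "'a::euclidean_space \<Rightarrow> 'b::euclidean_space" and g :: "'a \<Rightarrow> 'a"
  assumes "linear f" and "\<And>v. f (g v) = f v"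
  shows "dim (range f) \<le> dim (range g)"
proof -
  have "range f = f ` range g"
    using assms(2) by (auto simp: image_image)
  then show ?thesis
    using dim_image_le[OF \<open>linear f\<close>] by metis
qed

lemma submersion_near_range:
  assumes "submersion_near H \<pi> F k h U \<kappa>" "((\<kappa> \<circ> \<pi>) has_derivative D) (at h)"
  shows "range D = F"
  using assms unfolding submersion_near_def by (metis frechet_derivative_at)

lemma submersion_near_has_derivative:
  assumes "submersion_near H \<pi> F k h U \<kappa>"
  obtains D where "((\<kappa> \<circ> \<pi>) has_derivative D) (at h)"
proof -
  from assms have U: "open U" "h \<in> U" and "C1_on U (\<kappa> \<circ> \<pi>)"
    by (auto simp: submersion_near_def)
  then obtain f' where "((\<kappa> \<circ> \<pi>) has_derivative blinfun_apply (f' h)) (at h within U)"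
    unfolding C1_on_def by blast
  then show thesis
    using that at_within_open[OF U(2) U(1)] by metis
qed

text \<open>The neighbourhood \<open>N\<close> is kept apart from the chart domain \<open>U\<close>
  so that the lemma also covers a map that preserves classes only close to \<open>h\<close>. The
  points \<open>Q x\<close> may leave \<open>U\<close>: the classes already agree before
  \<open>\<kappa>\<close> is applied.\<close>

lemma submersion_near_derivative_factor:
  assumes sub: "submersion_near H \<pi> F k h U \<kappa>"
    and N: "open N" "h \<in> N" and "Q h = h" and eq: "\<And>x. x \<in> N \<Longrightarrow> \<pi> (Q x) = \<pi> x"
    and D: "((\<kappa> \<circ> \<pi>) has_derivative D) (at h)" and Q: "(Q has_derivative DQ) (at h)"
  shows "D (DQ v) = D v" and "k \<le> dim (range DQ)"
proof -
  show *: "D (DQ v) = D v" for v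
    using N \<open>Q h = h\<close> _ D Q by (rule has_derivative_fixed_point_factor) (simp add: eq)
  have "linear D" using D by (rule has_derivative_linear)
  then show "k \<le> dim (range DQ)"
    using dim_range_le_of_factor[of D DQ, OF _ *] submersion_near_range[OF sub D] sub
    by (simp add: submersion_near_def)
qed

text \<open>Rank-nullity as an inequality: \<open>f\<close> kills the component along its kernel
  \<open>K\<close>, so all its values are attained on the orthogonal complement \<open>C\<close>.
  Hence k \<le> \<open>dim C\<close> \<le> \<open>DIM('a)\<close>, and the subtraction is not
  truncated.\<close>

lemma dim_kernel_le:
  fixes f :: "'a::euclidean_space \<Rightarrow> 'b::euclidean_space"
  assumes "linear f" and "k \<le> dim (range f)"
  shows "dim {v. f v = 0} \<le> DIM('a) - k"
proof -
  define K where "K = {v. f v = 0}"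
  define C where "C = {y \<in> UNIV. \<forall>x\<in>K. orthogonal x y}"
  have K: "subspace K"
    unfolding K_def using \<open>linear f\<close> by (rule linear_subspace_kernel)
  have "dim C + dim K = DIM('a)"
    using dim_subspace_orthogonal_to_vectors[OF K subspace_UNIV] by (simp add: C_def)
  moreover have "range f \<subseteq> f ` C"
  proof clarify
    fix x
    obtain y z where "y \<in> span K" "\<And>w. w \<in> span K \<Longrightarrow> orthogonal z w" and x: "x = y + z"
      by (rule orthogonal_subspace_decomp_exists) blast
    then have "y \<in> K" "z \<in> C"
      using K by (auto simp: C_def span_eq_iff[THEN iffD2] orthogonal_commute)
    then have "f x = f z"
      using \<open>linear f\<close> by (simp add: K_def x linear_add)
    with \<open>z \<in> C\<close>
    show "f x \<in> f ` C" by blast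
  qed
  then have "dim (range f) \<le> dim C"
    using dim_subset dim_image_le[OF \<open>linear f\<close>] order_trans by blast
  ultimately show ?thesis
    using assms(2) by (simp add: K_def)
qed

text \<open>All three claims come from \<open>\<pi> (E s) = s\<close>: the representative
  \<open>E s\<close> has a class in \<open>V\<close> again, the same class, and hence the same
  representative.\<close>

lemma local_section_canonicalizer:
  assumes sec: "local_section H S \<pi> V E" and D: "D = {h \<in> H. \<pi> h \<in> V}"
  shows "E \<circ> \<pi> \<in> D \<rightarrow> D" and "semantics_preserving_on \<pi> D (E \<circ> \<pi>)"
    and "h \<in> D \<Longrightarrow> (E \<circ> \<pi>) ((E \<circ> \<pi>) h) = (E \<circ> \<pi>) h"
  using assms by (auto simp: local_section_def semantics_preserving_on_def)

text \<open>The main work is localisation. \<open>E\<close> is differentiable only in the chart and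
  relative to \<open>N\<close>, whereas the conclusion asks for a full derivative of
  \<open>E \<circ> \<pi>\<close> at \<open>E s\<close>.\<close>

lemma canonicalizer_rank:
  fixes H :: "(real ^ 'd) set" and F :: "'b::euclidean_space set"
  assumes sec: "local_section H S \<pi> V E" and "s \<in> V"
    and sub: "submersion_near H \<pi> F k (E s) U \<kappa>" and C1: "C1_near_in_chart \<pi> F U \<kappa> V E s"
  obtains DQ where "((E \<circ> \<pi>) has_derivative DQ) (at (E s))" "rank (matrix DQ) = k"
proof -
  have piE: "\<pi> (E t) = t" if "t \<in> V" for t
    using sec that by (auto simp: local_section_def)
  from sub have U: "open U" "E s \<in> U" and inj: "inj_on \<kappa> (\<pi> ` U)"
    and F: "\<kappa> ` \<pi> ` U \<subseteq> F" "dim F = k" and "C1_on U (\<kappa> \<circ> \<pi>)"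
    by (auto simp: submersion_near_def)
  then have cont: "continuous_on U (\<kappa> \<circ> \<pi>)"
    unfolding C1_on_def by (meson has_derivative_continuous_on)
  from C1 obtain N where N: "openin (top_of_set F) N" "\<kappa> s \<in> N" "N \<subseteq> \<kappa> ` (V \<inter> \<pi> ` U)"
    and "C1_on N (E \<circ> inv_into (\<pi> ` U) \<kappa>)"
    by (auto simp: C1_near_in_chart_def)
  then obtain L where L: "((E \<circ> inv_into (\<pi> ` U) \<kappa>) has_derivative L) (at (\<kappa> s) within N)"
    unfolding C1_on_def by blast
  define U' where "U' = U \<inter> (\<kappa> \<circ> \<pi>) -` N"
  from N(1) obtain T where T: "open T" "N = F \<inter> T"
    by (auto simp: openin_open)
  \<comment> \<open>\<open>N\<close> is open only relative to \<open>F\<close>. As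
    \<open>\<kappa> \<circ> \<pi>\<close> maps \<open>U\<close> into \<open>F\<close>, pulling back
    \<open>N\<close> or the ambient open set \<open>T\<close> gives the same set, which is therefore
    open.\<close>
  have "U' = U \<inter> (\<kappa> \<circ> \<pi>) -` T"
    using F(1) by (force simp: U'_def T)
  then have U': "open U'"
    using cont U(1) T(1) by (metis continuous_open_preimage)
  have Es: "E s \<in> U'"
    using U N piE[OF \<open>s \<in> V\<close>] by (simp add: U'_def)
  \<comment> \<open>Membership in \<open>N\<close> says only that \<open>\<kappa> (\<pi> x)\<close>
    is the coordinate of some class in \<open>V\<close>; injectivity of the chart identifies that
    class with \<open>\<pi> x\<close>.\<close>
  have V: "\<pi> x \<in> V" if "x \<in> U'" for x
  proof -
    from that have "x \<in> U" "\<kappa> (\<pi> x) \<in> \<kappa> ` (V \<inter> \<pi> ` U)"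
      using N(3) by (auto simp: U'_def)
    then show ?thesis
      using inj by (auto dest!: inj_onD)
  qed
  obtain D where D: "((\<kappa> \<circ> \<pi>) has_derivative D) (at (E s))"
    using submersion_near_has_derivative[OF sub] .
  have "(\<kappa> \<circ> \<pi>) ` U' \<subseteq> N" by (auto simp: U'_def)
  \<comment> \<open>\<open>L\<close> is a derivative within \<open>N\<close> only, so the chain rule
    is applied within \<open>U'\<close>, which is mapped into \<open>N\<close>. Openness of
    \<open>U'\<close> then lifts the restriction.\<close>
  then have "((E \<circ> inv_into (\<pi> ` U) \<kappa>) \<circ> (\<kappa> \<circ> \<pi>) has_derivative L \<circ> D) (at (E s) within U')"
    using D L piE[OF \<open>s \<in> V\<close>]
    by (intro diff_chain_within)
      (auto intro: has_derivative_at_withinI has_derivative_subset)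
  then have "((E \<circ> inv_into (\<pi> ` U) \<kappa>) \<circ> (\<kappa> \<circ> \<pi>) has_derivative L \<circ> D) (at (E s))"
    using at_within_open[OF Es U'] by simp
  \<comment> \<open>On \<open>U'\<close> the chart and its inverse cancel, leaving
    \<open>E \<circ> \<pi>\<close>.\<close>
  then have Q: "((E \<circ> \<pi>) has_derivative L \<circ> D) (at (E s))"
    using U' Es
    by (rule has_derivative_transform_within_open) (simp add: U'_def inj inv_into_f_f)
  have "linear L" using L by (rule has_derivative_linear)
  then have "dim (range (L \<circ> D)) \<le> k"
    using dim_image_le[of L "range D"] submersion_near_range[OF sub D] F(2)
    unfolding image_comp[symmetric] by simp
  \<comment> \<open>Here \<open>U'\<close> is the neighbourhood on which
    \<open>E \<circ> \<pi>\<close> preserves classes, and \<open>E s\<close> is its fixed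
    point.\<close>
  moreover have "k \<le> dim (range (L \<circ> D))"
    using sub U' Es _ _ D Q
    by (rule submersion_near_derivative_factor) (simp_all add: V piE \<open>s \<in> V\<close>)
  ultimately have "rank (matrix (L \<circ> D)) = k"
    using rank_matrix_eq_dim_range[OF has_derivative_linear[OF Q]] by simp
  with Q show thesis by (rule that)
qed

text \<open>Surjectivity of the projection is what forces any induced map to be the identity on all
  of the quotient.\<close>

lemma predictive_quotient_eq_image:
  "predictive_quotient H \<Phi> = predictive_proj H \<Phi> ` H"
  by (auto simp: predictive_proj_def predictive_quotient_def quotient_def)

theorem theorem2:
  fixes H :: "(real ^ 'd) set"
    and W :: "'w set"
    and M :: "'o measure"
    and P :: "real ^ 'd \<Rightarrow> 'o measure"
    and Y :: "'w \<Rightarrow> 'o \<Rightarrow> real"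
    and \<Phi> :: "real ^ 'd \<Rightarrow> 'w \<Rightarrow> real"
    and S :: "(real ^ 'd) set set"
    and \<pi> :: "real ^ 'd \<Rightarrow> (real ^ 'd) set"
    and F :: "'b::euclidean_space set"
    and k :: nat
  assumes model: "predictive_model H W M P Y"
    and \<Phi>: "\<Phi> = predictive_map W P Y"
    and S: "S = predictive_quotient H \<Phi>"
    and \<pi>: "\<pi> = predictive_proj H \<Phi>"
  shows
    "(\<forall>Q. Q \<in> H \<rightarrow> H \<and> semantics_preserving_on \<pi> H Q \<longrightarrow>
        induces_on_quotient H S \<pi> Q id \<and>
        (\<forall>f. induces_on_quotient H S \<pi> Q f \<longrightarrow> (\<forall>s\<in>S. f s = s)) \<and>
        (\<forall>h U \<kappa> D\<pi> DQ.
           submersion_near H \<pi> F k h U \<kappa> \<and> Q h = h \<and>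
           ((\<kappa> \<circ> \<pi>) has_derivative D\<pi>) (at h) \<and> (Q has_derivative DQ) (at h) \<longrightarrow>
             (\<forall>v. D\<pi> (DQ v - v) = 0) \<and>
             rank (matrix DQ) \<ge> k \<and>
             dim {v. DQ v = 0} \<le> CARD('d) - k \<and>
             (\<forall>B. independent B \<and> (\<forall>v\<in>B. DQ v = 0) \<longrightarrow>
                finite B \<and> card B \<le> CARD('d) - k)))
     \<and>
     (\<forall>V E. C1_local_section H S \<pi> F k V E \<longrightarrow>
        (let D = {h \<in> H. \<pi> h \<in> V}; Qstar = E \<circ> \<pi> in
           Qstar \<in> D \<rightarrow> D \<and>
           semantics_preserving_on \<pi> D Qstar \<and>
           (\<forall>h\<in>D. Qstar (Qstar h) = Qstar h) \<and>
           (\<forall>x\<in>E ` V. \<exists>DQ. (Qstar has_derivative DQ) (at x) \<and> rank (matrix DQ) = k)))"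
proof (intro conjI allI impI)
  fix Q
  assume "Q \<in> H \<rightarrow> H \<and> semantics_preserving_on \<pi> H Q"
  then have pres: "\<And>h. h \<in> H \<Longrightarrow> \<pi> (Q h) = \<pi> h"
    by (auto simp: semantics_preserving_on_def)
  have S_eq: "S = \<pi> ` H"
    unfolding S \<pi> by (rule predictive_quotient_eq_image)
  show "induces_on_quotient H S \<pi> Q id"
    by (simp add: induces_on_quotient_def pres)
  show "\<forall>s\<in>S. f s = s" if "induces_on_quotient H S \<pi> Q f" for f
    using that by (auto simp: induces_on_quotient_def pres S_eq)
  fix h U \<kappa> D\<pi> DQ
  assume "submersion_near H \<pi> F k h U \<kappa> \<and> Q h = h \<and>
    ((\<kappa> \<circ> \<pi>) has_derivative D\<pi>) (at h) \<and> (Q has_derivative DQ) (at h)"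
  then have sub: "submersion_near H \<pi> F k h U \<kappa>" and "Q h = h"
    and D\<pi>: "((\<kappa> \<circ> \<pi>) has_derivative D\<pi>) (at h)" and DQ: "(Q has_derivative DQ) (at h)"
    by auto
  then have U: "open U" "h \<in> U" "U \<subseteq> H"
    by (auto simp: submersion_near_def)
  \<comment> \<open>Because \<open>U\<close> lies in \<open>H\<close>, preservation on
    \<open>H\<close> holds on the whole open set \<open>U\<close>, which can serve as the
    neighbourhood.\<close>
  have factor: "D\<pi> (DQ v) = D\<pi> v" and range: "k \<le> dim (range DQ)" for v
    using submersion_near_derivative_factor[OF sub U(1,2) \<open>Q h = h\<close> _ D\<pi> DQ] pres U(3)
    by blast+
  have lin: "linear DQ" using DQ by (rule has_derivative_linear)
  show "D\<pi> (DQ v - v) = 0" for v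
    using factor linear_diff[OF has_derivative_linear[OF D\<pi>]] by simp
  show "rank (matrix DQ) \<ge> k"
    using range by (simp add: rank_matrix_eq_dim_range[OF lin])
  show ker: "dim {v. DQ v = 0} \<le> CARD('d) - k"
    using dim_kernel_le[OF lin range] by simp
  fix B
  assume B: "independent B \<and> (\<forall>v\<in>B. DQ v = 0)"
  \<comment> \<open>Finiteness is a separate claim because \<open>card\<close> is 0 on infinite
    sets, where the bound would say nothing.\<close>
  then show "finite B" using independent_imp_finite by blast
  have "card B \<le> dim {v. DQ v = 0}"
    using B by (intro independent_card_le_dim) auto
  with ker show "card B \<le> CARD('d) - k" by simp
next
  fix V E
  assume E: "C1_local_section H S \<pi> F k V E"
  then have sec: "local_section H S \<pi> V E"
    by (simp add: C1_local_section_def)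
  have "\<exists>DQ. ((E \<circ> \<pi>) has_derivative DQ) (at x) \<and> rank (matrix DQ) = k"
    if "x \<in> E ` V" for x
    using that E canonicalizer_rank[OF sec] unfolding C1_local_section_def by blast
  then show "let D = {h \<in> H. \<pi> h \<in> V}; Qstar = E \<circ> \<pi> in
      Qstar \<in> D \<rightarrow> D \<and> semantics_preserving_on \<pi> D Qstar \<and>
      (\<forall>h\<in>D. Qstar (Qstar h) = Qstar h) \<and>
      (\<forall>x\<in>E ` V. \<exists>DQ. (Qstar has_derivative DQ) (at x) \<and> rank (matrix DQ) = k)"
    using local_section_canonicalizer[OF sec refl] unfolding Let_def by blast
qed

end
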